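(* For all positive integers $m,n$, $$\dim \mathscr{M}(\boldsymbol{m}\times\boldsymbol{n})=(m-1)(n-1).$$
   Context: $\boldsymbol{n}=\{1,\dots,n\}$ denotes the $n$-element chain with its usual order. The direct product $\boldsymbol{m}\times\boldsymbol{n}$ is the set of pairs $(s,t)$ with $s\in\boldsymbol{m}$, $t\in\boldsymbol{n}$, ordered by $(s_1,t_1)\le(s_2,t_2)$ iff $s_1\le s_2$ and $t_1\le t_2$. For a finite poset $P$ with $p$ elements, $\mathrm{MaxChain}(P)$ is the set of all maximal chains of $P$ (maximal with respect to inclusion); for $Q\subset P$, $e_Q=\sum_{x\in Q}e_x\in\mathbb{R}^p$ with $e_x$ the standard unit vectors (indexed by elements of $P$). The maximal chain polytope $\mathscr{M}(P)$ is the convex hull of $\{e_C\mid C\in\mathrm{MaxChain}(P)\}$ in $\mathbb{R}^p$, and $\dim$ denotes the dimension of its affine hull. *)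

theory Defs
  imports "HOL-Analysis.Analysis" "HOL-Analysis.Finite_Function_Topology" "HOL-Library.Product_Order"
begin

definition max_chains :: "'a::order set \<Rightarrow> 'a set set" where
  "max_chains P = {C. pred_on.maxchain P (\<le>) C}"

text \<open>
  For a finite subset \<open>P\<close> of \<open>'a\<close>, the space \<open>\<real>\<^sup>p\<close> with coordinates indexed by the elements of \<open>P\<close>
  is the subspace of the finitely supported functions \<open>'a \<Rightarrow>\<^sub>0 real\<close> whose support is contained
  in \<open>P\<close>. Convex hulls, affine hulls and their dimensions do not depend on the ambient space,
  so it is not necessary to restrict to that subspace.
\<close>

definition indicator_vec :: "'a set \<Rightarrow> 'a \<Rightarrow>\<^sub>0 real" where
  "indicator_vec Q = (\<Sum>x\<in>Q. Poly_Mapping.single x 1)"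

definition max_chain_polytope :: "'a::order set \<Rightarrow> ('a \<Rightarrow>\<^sub>0 real) set" where
  "max_chain_polytope P = convex hull (indicator_vec ` max_chains P)"

text \<open>
  The library constant \<^const>\<open>aff_dim\<close> is restricted to type class \<^class>\<open>euclidean_space\<close>, which
  does not include \<open>'a \<Rightarrow>\<^sub>0 real\<close>. The dimension of the affine hull is therefore defined as the
  dimension of its direction space.
\<close>

definition affine_dim :: "'a::real_vector set \<Rightarrow> nat" where
  "affine_dim S = dim {x - y | x y. x \<in> affine hull S \<and> y \<in> affine hull S}"

lemma affine_dim_eq_aff_dim:
  fixes S :: "'a::euclidean_space set"
  assumes "S \<noteq> {}"
  shows "int (affine_dim S) = aff_dim S"
proof -
  let ?A = "affine hull S"
  from assms obtain a where a: "a \<in> ?A"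
    by (meson all_not_in_conv hull_inc)
  have 1: "{x - y | x y. x \<in> ?A \<and> y \<in> ?A} = (\<lambda>x. - a + x) ` ?A" (is "?D = ?T")
  proof
    show "?D \<subseteq> ?T"
    proof
      fix z assume "z \<in> ?D"
      then obtain x y where z: "z = x - y" "x \<in> ?A" "y \<in> ?A" by blast
      have "a + 1 *\<^sub>R (x - y) \<in> ?A"
        using mem_affine_3_minus[OF affine_affine_hull a z(2,3)] .
      then show "z \<in> ?T"
        by (intro image_eqI[where x = "a + (x - y)"]) (auto simp: z)
    qed
    show "?T \<subseteq> ?D" using a by auto
  qed
  have "int (dim ?T) = aff_dim ?A"
    using aff_dim_eq_dim[OF hull_inc[OF a, of affine]] by simp
  then show ?thesis by (simp add: affine_dim_def 1)
qed

end

theory Submission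
  imports Defs
begin

text \<open>
  Grade the grid \<open>{1..m} \<times> {1..n}\<close> by the rank \<open>s + t\<close> of \<open>(s, t)\<close>. A chain of the grid is
  maximal iff it meets every rank from \<open>2\<close> to \<open>m + n\<close>, and it meets each of them only once
  (\<open>maximal_chain_meets_rank\<close>, \<open>maximal_chainI\<close>, \<open>chain_inj_on_rank\<close>). The difference of two
  vertices of the polytope is therefore a sum of differences \<open>e\<^sub>x - e\<^sub>y\<close> with \<open>x\<close> and \<open>y\<close> of equal
  rank. Moving along an antidiagonal one step at a time, each of these is a sum of the vectors
  \<open>e\<^sub>(\<^sub>i\<^sub>+\<^sub>1\<^sub>,\<^sub>j\<^sub>) - e\<^sub>(\<^sub>i\<^sub>,\<^sub>j\<^sub>+\<^sub>1\<^sub>)\<close>, one for each of the \<open>(m - 1)(n - 1)\<close> unit squares of the grid, or of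
  their negatives.

  Conversely, the vector of a unit square is itself a difference of two vertices: choose a
  maximal chain through \<open>(i, j)\<close> and \<open>(i + 1, j + 1)\<close> and let it turn around the square in the two
  possible ways. Since the square vectors are linearly independent
  (\<open>independent_square_vecs\<close>), they form a basis of the direction space of the affine hull.
\<close>

section \<open>Dimension from a basis of differences\<close>

text \<open>
  The vectors \<open>B\<close> are a basis of the direction space as soon as they are differences of
  generators and span all such differences, because translating the affine hull of \<open>V\<close> by
  a point of \<open>V\<close> puts it inside the linear subspace \<open>span B\<close>.
\<close>

lemma affine_dim_convex_hull_eq_card:
  fixes V B :: "'a::real_vector set"
  assumes indep: "independent B"
    and diff_in_span: "\<And>x y. x \<in> V \<Longrightarrow> y \<in> V \<Longrightarrow> x - y \<in> span B"
    and basis_is_diff: "\<And>b. b \<in> B \<Longrightarrow> \<exists>x\<in>V. \<exists>y\<in>V. b = x - y"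
  shows "affine_dim (convex hull V) = card B"
proof -
  define D where "D = {x - y | x y. x \<in> affine hull V \<and> y \<in> affine hull V}"
  have "D \<subseteq> span B"
  proof
    fix z assume "z \<in> D"
    then obtain x y where xy: "x \<in> affine hull V" "y \<in> affine hull V" and z: "z = x - y"
      by (auto simp: D_def)
    from xy(1) obtain a where a: "a \<in> V"
      by fastforce
    have "affine hull V \<subseteq> (+) a ` span B"
    proof (rule hull_minimal)
      show "V \<subseteq> (+) a ` span B"
      proof
        fix v assume "v \<in> V"
        then show "v \<in> (+) a ` span B"
          using diff_in_span[OF _ a] by (intro image_eqI[where x = "v - a"]) auto
      qed
      show "affine ((+) a ` span B)"
        using affine_translation subspace_imp_affine[OF subspace_span] by blast
    qed
    then obtain u v where "u \<in> span B" "v \<in> span B" "x = a + u" "y = a + v"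
      using xy by blast
    then show "z \<in> span B"
      by (simp add: z span_diff)
  qed
  moreover have "B \<subseteq> D"
    using basis_is_diff by (fastforce simp: D_def intro: hull_inc)
  ultimately have "span B = span D"
    by (metis span_mono span_span subset_antisym)
  then have "dim D = card B"
    using indep by (rule dim_eq_card)
  then show ?thesis
    by (simp add: affine_dim_def D_def affine_hull_convex_hull)
qed

section \<open>Maximal chains of the grid\<close>

definition grid_rank :: "nat \<times> nat \<Rightarrow> nat" where
  "grid_rank x = fst x + snd x"

lemma eq_if_comparable_same_rank:
  assumes "x \<le> y \<or> y \<le> x" and "grid_rank x = grid_rank y"
  shows "x = y"
  using assms by (auto simp: grid_rank_def less_eq_prod_def prod_eq_iff)

lemma chain_inj_on_rank:
  assumes "pred_on.chain P (\<le>) C"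
  shows "inj_on grid_rank C"
proof (rule inj_onI)
  fix x y assume "x \<in> C" "y \<in> C" and eq: "grid_rank x = grid_rank y"
  with assms have "x \<le> y \<or> y \<le> x"
    by (simp add: pred_on.chain_def)
  then show "x = y"
    using eq by (rule eq_if_comparable_same_rank)
qed

lemma rank_in_grid:
  assumes "x \<in> {1..m} \<times> {1..n}"
  shows "grid_rank x \<in> {2..m + n}"
  using assms by (auto simp: grid_rank_def)

text \<open>
  Walk from \<open>x\<close> to \<open>y\<close> by raising the first coordinate and then the second:
  each step raises the rank by one. The two cases are the two legs of this walk.
\<close>

lemma intermediate_rank:
  assumes "x \<le> y" and "grid_rank x \<le> r" and "r \<le> grid_rank y"
  obtains z where "x \<le> z" and "z \<le> y" and "grid_rank z = r"
proof (cases "r - snd x \<le> fst y")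
  case True
  show ?thesis
    by (rule that[of "(r - snd x, snd x)"])
       (use assms True in \<open>auto simp: grid_rank_def less_eq_prod_def\<close>)
next
  case False
  show ?thesis
    by (rule that[of "(fst y, r - fst y)"])
       (use assms False in \<open>auto simp: grid_rank_def less_eq_prod_def\<close>)
qed

lemma maximal_chain_absorbs:
  assumes C: "C \<in> max_chains P" and "z \<in> P"
    and "\<And>c. c \<in> C \<Longrightarrow> c \<le> z \<or> z \<le> c"
  shows "z \<in> C"
proof (rule ccontr)
  assume "z \<notin> C"
  have "pred_on.chain P (\<le>) (insert z C)"
    using assms by (auto simp: max_chains_def pred_on.maxchain_def pred_on.chain_def)
  with \<open>z \<notin> C\<close> C show False
    by (auto simp: max_chains_def pred_on.maxchain_def)
qed

text \<open>
  A chain that skips the rank \<open>r\<close> splits into a part below and a part above \<open>r\<close>. A point of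
  rank \<open>r\<close> between the top of the lower and the bottom of the upper part is comparable to
  the whole chain, which is then not maximal.
\<close>

lemma maximal_chain_meets_rank:
  assumes C: "C \<in> max_chains ({1..m} \<times> {1..n})" and r: "r \<in> {2..m + n}"
    and m: "m \<ge> 1" and n: "n \<ge> 1"
  shows "\<exists>x\<in>C. grid_rank x = r"
proof -
  have chain: "pred_on.chain ({1..m} \<times> {1..n}) (\<le>) C"
    using C by (simp add: max_chains_def pred_on.maxchain_def)
  then have sub: "C \<subseteq> {1..m} \<times> {1..n}"
    by (simp add: pred_on.chain_def)
  have total: "x \<le> y \<or> y \<le> x" if "x \<in> C" "y \<in> C" for x y
    using chain that by (auto simp: pred_on.chain_def)
  have bot: "(1, 1) \<in> C"
    by (rule maximal_chain_absorbs[OF C]) (use m n sub in \<open>auto simp: less_eq_prod_def\<close>)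
  have top: "(m, n) \<in> C"
    by (rule maximal_chain_absorbs[OF C]) (use m n sub in \<open>auto simp: less_eq_prod_def\<close>)
  obtain x where x: "x \<in> C" "grid_rank x \<le> r" and x_max: "\<And>c. c \<in> C \<Longrightarrow> grid_rank c \<le> r \<Longrightarrow> grid_rank c \<le> grid_rank x"
    using ex_has_greatest_nat[of "\<lambda>c. c \<in> C \<and> grid_rank c \<le> r" "(1, 1)" grid_rank "Suc r"] bot r
    by (auto simp: grid_rank_def less_Suc_eq_le)
  obtain y where y: "y \<in> C" "r \<le> grid_rank y" and y_min: "\<And>c. c \<in> C \<Longrightarrow> r \<le> grid_rank c \<Longrightarrow> grid_rank y \<le> grid_rank c"
    using ex_has_least_nat[of "\<lambda>c. c \<in> C \<and> r \<le> grid_rank c" "(m, n)" grid_rank] top r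
    by (auto simp: grid_rank_def)
  have le_if_rank_le: "c \<le> d" if "c \<in> C" "d \<in> C" "grid_rank c \<le> grid_rank d" for c d
    using total[OF that(1,2)] that(3) by (auto simp: grid_rank_def less_eq_prod_def)
  have "x \<le> y"
    using x y by (intro le_if_rank_le) auto
  then obtain z where z: "x \<le> z" "z \<le> y" "grid_rank z = r"
    using intermediate_rank x(2) y(2) by blast
  have "z \<in> C"
  proof (rule maximal_chain_absorbs[OF C])
    have "x \<in> {1..m} \<times> {1..n}" "y \<in> {1..m} \<times> {1..n}"
      using sub x y by auto
    then show "z \<in> {1..m} \<times> {1..n}"
      using z(1,2) by (cases x; cases y; cases z) auto
    show "c \<le> z \<or> z \<le> c" if "c \<in> C" for c
    proof (cases "grid_rank c \<le> r")
      case True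
      then have "c \<le> x" using that x x_max le_if_rank_le by blast
      then show ?thesis using z(1) by (meson order_trans)
    next
      case False
      then have "y \<le> c" using that y y_min le_if_rank_le by auto
      then show ?thesis using z(2) by (meson order_trans)
    qed
  qed
  with z(3) show ?thesis by blast
qed

lemma maximal_chain_bij_betw_rank:
  assumes C: "C \<in> max_chains ({1..m} \<times> {1..n})" and "m \<ge> 1" "n \<ge> 1"
  shows "bij_betw grid_rank C {2..m + n}"
proof -
  have chain: "pred_on.chain ({1..m} \<times> {1..n}) (\<le>) C"
    using C by (simp add: max_chains_def pred_on.maxchain_def)
  then have "C \<subseteq> {1..m} \<times> {1..n}"
    by (simp add: pred_on.chain_def)
  then have "grid_rank ` C \<subseteq> {2..m + n}"
    using rank_in_grid by blast
  moreover have "{2..m + n} \<subseteq> grid_rank ` C"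
    using maximal_chain_meets_rank[OF C _ assms(2,3)] by blast
  ultimately show ?thesis
    using chain_inj_on_rank[OF chain] unfolding bij_betw_def by blast
qed

text \<open>
  Maximality holds because a new point would have the rank of some point already present, to
  which it cannot be comparable.
\<close>

lemma maximal_chainI:
  assumes sub: "C \<subseteq> {1..m} \<times> {1..n}"
    and total: "\<And>x y. x \<in> C \<Longrightarrow> y \<in> C \<Longrightarrow> x \<le> y \<or> y \<le> x"
    and ranks: "\<And>r. r \<in> {2..m + n} \<Longrightarrow> r \<in> grid_rank ` C"
  shows "C \<in> max_chains ({1..m} \<times> {1..n})"
proof -
  have "S \<subseteq> C" if S: "pred_on.chain ({1..m} \<times> {1..n}) (\<le>) S" and "C \<subseteq> S" for S
  proof
    fix x assume "x \<in> S"
    moreover have "S \<subseteq> {1..m} \<times> {1..n}"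
      using S by (simp add: pred_on.chain_def)
    ultimately have "grid_rank x \<in> {2..m + n}"
      by (intro rank_in_grid) blast
    then have "grid_rank x \<in> grid_rank ` C"
      by (rule ranks)
    then show "x \<in> C"
      using \<open>x \<in> S\<close> \<open>C \<subseteq> S\<close> inj_on_image_mem_iff[OF chain_inj_on_rank[OF S]] by blast
  qed
  moreover have "pred_on.chain ({1..m} \<times> {1..n}) (\<le>) C"
    using sub total by (simp add: pred_on.chain_def)
  ultimately show ?thesis
    unfolding max_chains_def pred_on.maxchain_def by blast
qed

section \<open>The vectors of the unit squares\<close>

abbreviation unit_vec :: "'a \<Rightarrow> 'a \<Rightarrow>\<^sub>0 real" where
  "unit_vec x \<equiv> Poly_Mapping.single x 1"

lemma lookup_scaleR: "Poly_Mapping.lookup (r *\<^sub>R x) i = r *\<^sub>R Poly_Mapping.lookup x i"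
proof -
  have "finite {i. r *\<^sub>R Poly_Mapping.lookup x i \<noteq> 0}"
    by (rule finite_subset[OF _ finite_lookup[of x]]) auto
  then show ?thesis
    by (simp add: scaleR_poly_mapping_def Abs_poly_mapping_inverse)
qed

text \<open>
  The square with lower corner \<open>(i, j)\<close>, given as a pair so that families of squares
  are sets of grid points.
\<close>

definition square_vec :: "nat \<times> nat \<Rightarrow> (nat \<times> nat) \<Rightarrow>\<^sub>0 real" where
  "square_vec = (\<lambda>(i, j). unit_vec (i + 1, j) - unit_vec (i, j + 1))"

lemma lookup_square_vec:
  "Poly_Mapping.lookup (square_vec (i, j)) x =
    (if x = (i + 1, j) then 1 else 0) - (if x = (i, j + 1) then 1 else 0)"
  by (auto simp: square_vec_def lookup_minus lookup_single when_def)

lemma inj_square_vec: "inj square_vec"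
proof (rule injI)
  fix p q :: "nat \<times> nat"
  assume eq: "square_vec p = square_vec q"
  obtain i j where p: "p = (i, j)" by fastforce
  obtain k l where q: "q = (k, l)" by fastforce
  have "Poly_Mapping.lookup (square_vec (k, l)) (i + 1, j) = 1"
    unfolding q[symmetric] eq[symmetric] by (simp add: p lookup_square_vec)
  then show "p = q"
    by (auto simp: p q lookup_square_vec split: if_splits)
qed

text \<open>
  The family is triangular: the only square vectors with a nonzero coordinate at
  \<open>(i + 1, j)\<close> are those of \<open>(i, j)\<close> and, for \<open>j > 0\<close>, of \<open>(i + 1, j - 1)\<close>. In a linear relation the coefficients
  thus vanish row by row, with increasing \<open>j\<close>.
\<close>

lemma independent_square_vecs:
  assumes fin: "finite I"
  shows "independent (square_vec ` I)"
proof -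
  have zero: "c (i, j) = 0"
    if rel: "(\<Sum>p\<in>I. c p *\<^sub>R square_vec p) = 0" and "(i, j) \<in> I" for c i j
    using \<open>(i, j) \<in> I\<close>
  proof (induction j arbitrary: i rule: less_induct)
    case (less j)
    have others: "c p * Poly_Mapping.lookup (square_vec p) (i + 1, j) = 0" if "p \<in> I - {(i, j)}" for p
    proof (cases "p = (i + 1, j - 1) \<and> 0 < j")
      case True
      then show ?thesis using less.IH[of "j - 1" "i + 1"] that by auto
    next
      case False
      then show ?thesis using that by (cases p) (auto simp: lookup_square_vec)
    qed
    have "0 = Poly_Mapping.lookup (\<Sum>p\<in>I. c p *\<^sub>R square_vec p) (i + 1, j)"
      by (simp add: rel)
    also have "\<dots> = (\<Sum>p\<in>I. c p * Poly_Mapping.lookup (square_vec p) (i + 1, j))"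
      by (simp add: lookup_sum lookup_scaleR)
    also have "\<dots> = c (i, j) * Poly_Mapping.lookup (square_vec (i, j)) (i + 1, j)"
      by (simp only: sum.remove[OF fin less.prems] sum.neutral[OF ballI[OF others]] add_0_right)
    also have "\<dots> = c (i, j)"
      by (simp add: lookup_square_vec)
    finally show ?case by simp
  qed
  show ?thesis
  proof (subst dependent_finite)
    show "finite (square_vec ` I)" using fin by simp
    show "\<not> (\<exists>u. (\<exists>v\<in>square_vec ` I. u v \<noteq> 0) \<and> (\<Sum>v\<in>square_vec ` I. u v *\<^sub>R v) = 0)"
    proof clarify
      fix u i j
      assume "(\<Sum>v\<in>square_vec ` I. u v *\<^sub>R v) = 0" and "(i, j) \<in> I"
        and nz: "u (square_vec (i, j)) \<noteq> 0"
      then have "(\<Sum>p\<in>I. u (square_vec p) *\<^sub>R square_vec p) = 0"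
        by (simp add: sum.reindex[OF inj_on_subset[OF inj_square_vec subset_UNIV]])
      from zero[OF this \<open>(i, j) \<in> I\<close>] nz show False by simp
    qed
  qed
qed

abbreviation squares :: "nat \<Rightarrow> nat \<Rightarrow> (nat \<times> nat) set" where
  "squares m n \<equiv> {1..<m} \<times> {1..<n}"

text \<open>
  The sum of the square vectors along an antidiagonal telescopes.
\<close>

lemma antidiagonal_diff_in_span:
  assumes "1 \<le> i" "i + k \<le> m" "1 \<le> j" "j + k \<le> n"
  shows "unit_vec (i + k, j) - unit_vec (i, j + k) \<in> span (square_vec ` squares m n)"
  using assms
proof (induction k arbitrary: j)
  case 0
  then show ?case by (simp add: span_zero)
next
  case (Suc k)
  have "unit_vec (i + k, j + 1) - unit_vec (i, j + 1 + k) \<in> span (square_vec ` squares m n)"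
    using Suc by (intro Suc.IH) auto
  moreover have "square_vec (i + k, j) \<in> span (square_vec ` squares m n)"
    using Suc.prems by (intro span_base imageI) auto
  ultimately have "square_vec (i + k, j) + (unit_vec (i + k, j + 1) - unit_vec (i, j + 1 + k))
      \<in> span (square_vec ` squares m n)"
    by (intro span_add)
  then show ?case by (simp add: square_vec_def)
qed

lemma same_rank_diff_in_span:
  assumes x: "x \<in> {1..m} \<times> {1..n}" and y: "y \<in> {1..m} \<times> {1..n}"
    and eq: "grid_rank x = grid_rank y"
  shows "unit_vec x - unit_vec y \<in> span (square_vec ` squares m n)"
proof -
  have *: "unit_vec x - unit_vec y \<in> span (square_vec ` squares m n)"
    if x: "x \<in> {1..m} \<times> {1..n}" and y: "y \<in> {1..m} \<times> {1..n}" and eq: "grid_rank x = grid_rank y"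
      and le: "fst y \<le> fst x" for x y
  proof -
    have "x = (fst y + (fst x - fst y), snd x)" and "y = (fst y, snd x + (fst x - fst y))"
      using eq le by (auto simp: grid_rank_def prod_eq_iff)
    moreover have "1 \<le> fst y" "fst y + (fst x - fst y) \<le> m" "1 \<le> snd x" "snd x + (fst x - fst y) \<le> n"
      using x y eq le by (auto simp: grid_rank_def)
    ultimately show ?thesis
      using antidiagonal_diff_in_span by metis
  qed
  show ?thesis
  proof (cases "fst y \<le> fst x")
    case True
    then show ?thesis using * x y eq by blast
  next
    case False
    then have "unit_vec y - unit_vec x \<in> span (square_vec ` squares m n)"
      using * x y eq by simp
    then show ?thesis using span_neg by fastforce
  qed
qed

section \<open>Square vectors and vertices of the polytope\<close>

text \<open>
  Two maximal chains are matched rank by rank, which splits the difference of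
  their vectors into differences of unit vectors of equal rank.
\<close>

lemma vertex_diff_in_span:
  assumes C: "C \<in> max_chains ({1..m} \<times> {1..n})" and D: "D \<in> max_chains ({1..m} \<times> {1..n})"
    and mn: "m \<ge> 1" "n \<ge> 1"
  shows "indicator_vec C - indicator_vec D \<in> span (square_vec ` squares m n)"
proof -
  have by_rank: "\<exists>f. indicator_vec E = (\<Sum>r\<in>{2..m + n}. unit_vec (f r)) \<and>
      (\<forall>r\<in>{2..m + n}. f r \<in> {1..m} \<times> {1..n} \<and> grid_rank (f r) = r)"
    if E: "E \<in> max_chains ({1..m} \<times> {1..n})" for E
  proof -
    let ?f = "the_inv_into E grid_rank"
    have bij: "bij_betw grid_rank E {2..m + n}"
      using maximal_chain_bij_betw_rank[OF E mn] .
    have bij': "bij_betw ?f {2..m + n} E"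
      using bij by (rule bij_betw_the_inv_into)
    have "indicator_vec E = (\<Sum>r\<in>{2..m + n}. unit_vec (?f r))"
      unfolding indicator_vec_def by (rule sum.reindex_bij_betw[OF bij', symmetric])
    moreover have "E \<subseteq> {1..m} \<times> {1..n}"
      using E by (simp add: max_chains_def pred_on.maxchain_def pred_on.chain_def)
    moreover have "?f r \<in> E \<and> grid_rank (?f r) = r" if "r \<in> {2..m + n}" for r
      using bij bij' that by (metis bij_betwE f_the_inv_into_f_bij_betw)
    ultimately show ?thesis by blast
  qed
  obtain f where f: "indicator_vec C = (\<Sum>r\<in>{2..m + n}. unit_vec (f r))"
      "\<And>r. r \<in> {2..m + n} \<Longrightarrow> f r \<in> {1..m} \<times> {1..n} \<and> grid_rank (f r) = r"
    using by_rank[OF C] by blast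
  obtain g where g: "indicator_vec D = (\<Sum>r\<in>{2..m + n}. unit_vec (g r))"
      "\<And>r. r \<in> {2..m + n} \<Longrightarrow> g r \<in> {1..m} \<times> {1..n} \<and> grid_rank (g r) = r"
    using by_rank[OF D] by blast
  have "indicator_vec C - indicator_vec D = (\<Sum>r\<in>{2..m + n}. unit_vec (f r) - unit_vec (g r))"
    by (simp add: f(1) g(1) sum_subtractf)
  also have "\<dots> \<in> span (square_vec ` squares m n)"
    using f(2) g(2) by (intro span_sum same_rank_diff_in_span) metis+
  finally show ?thesis .
qed

text \<open>
  The two chains share a lattice path that goes from \<open>(1, 1)\<close> through \<open>(1, j)\<close> to \<open>(i, j)\<close>, and
  from \<open>(i + 1, j + 1)\<close> through \<open>(i + 1, n)\<close> to \<open>(m, n)\<close>. The common part misses only the rank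
  \<open>i + j + 1\<close>, at which the chains use the two remaining corners of the square.
\<close>

lemma square_vec_is_vertex_diff:
  assumes "(i, j) \<in> squares m n"
  shows "\<exists>C\<in>max_chains ({1..m} \<times> {1..n}). \<exists>D\<in>max_chains ({1..m} \<times> {1..n}).
    square_vec (i, j) = indicator_vec C - indicator_vec D"
proof -
  define K where
    "K = {1} \<times> {1..j} \<union> {1..i} \<times> {j} \<union> {i + 1} \<times> {j + 1..n} \<union> {i + 1..m} \<times> {n}"
  have ij: "1 \<le> i" "i < m" "1 \<le> j" "j < n"
    using assms by auto
  have K_ranks: "r \<in> grid_rank ` K" if r: "r \<in> {2..m + n}" "r \<noteq> i + j + 1" for r
  proof -
    consider "r \<le> j + 1" | "j + 1 < r" "r \<le> i + j" | "i + j + 2 \<le> r" "r \<le> i + 1 + n" | "i + 1 + n < r"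
      using r by linarith
    then show ?thesis
    proof cases
      case 1
      with r ij show ?thesis
        by (intro image_eqI[where x = "(1, r - 1)"]) (auto simp: grid_rank_def K_def)
    next
      case 2
      with r ij show ?thesis
        by (intro image_eqI[where x = "(r - j, j)"]) (auto simp: grid_rank_def K_def)
    next
      case 3
      with r ij show ?thesis
        by (intro image_eqI[where x = "(i + 1, r - (i + 1))"]) (auto simp: grid_rank_def K_def)
    next
      case 4
      with r ij show ?thesis
        by (intro image_eqI[where x = "(r - n, n)"]) (auto simp: grid_rank_def K_def)
    qed
  qed
  have max: "insert p K \<in> max_chains ({1..m} \<times> {1..n})"
    if p: "p = (i + 1, j) \<or> p = (i, j + 1)" for p
  proof (rule maximal_chainI)
    show "insert p K \<subseteq> {1..m} \<times> {1..n}"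
      using p ij by (auto simp: K_def)
    show "x \<le> y \<or> y \<le> x" if "x \<in> insert p K" "y \<in> insert p K" for x y
      using that p ij by (auto simp: K_def)
    show "r \<in> grid_rank ` insert p K" if "r \<in> {2..m + n}" for r
      using K_ranks[OF that] p by (cases "r = i + j + 1") (auto simp: grid_rank_def)
  qed
  have "finite K"
    by (simp add: K_def)
  moreover have "(i + 1, j) \<notin> K" "(i, j + 1) \<notin> K"
    using ij by (auto simp: K_def)
  ultimately have "square_vec (i, j) = indicator_vec (insert (i + 1, j) K) - indicator_vec (insert (i, j + 1) K)"
    by (simp add: square_vec_def indicator_vec_def)
  then show ?thesis
    using max by blast
qed

theorem theorem3p21:
  fixes m n :: nat
  assumes "m \<ge> 1" and "n \<ge> 1"
  shows "affine_dim (max_chain_polytope ({1..m} \<times> {1..n})) = (m - 1) * (n - 1)"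
proof -
  have "affine_dim (max_chain_polytope ({1..m} \<times> {1..n})) = card (square_vec ` squares m n)"
    unfolding max_chain_polytope_def
  proof (rule affine_dim_convex_hull_eq_card)
    show "independent (square_vec ` squares m n)"
      by (rule independent_square_vecs) simp
    show "x - y \<in> span (square_vec ` squares m n)"
      if "x \<in> indicator_vec ` max_chains ({1..m} \<times> {1..n})"
        and "y \<in> indicator_vec ` max_chains ({1..m} \<times> {1..n})" for x y
      using that vertex_diff_in_span[OF _ _ assms] by blast
    show "\<exists>x\<in>indicator_vec ` max_chains ({1..m} \<times> {1..n}).
        \<exists>y\<in>indicator_vec ` max_chains ({1..m} \<times> {1..n}). b = x - y"
      if "b \<in> square_vec ` squares m n" for b
      using that square_vec_is_vertex_diff[of _ _ m n] by blast
  qed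
  also have "\<dots> = card (squares m n)"
    by (rule card_image) (rule inj_on_subset[OF inj_square_vec subset_UNIV])
  finally show ?thesis
    by simp
qed

end
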